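(* Let $\alpha_1,\alpha_2,\alpha_3\in(0,1]$, $A\in\mathbb{R}^{3\times 3}$, and suppose that the characteristic function $Q(s)=\det(\operatorname{diag}(s^{\alpha_1},s^{\alpha_2},s^{\alpha_3})-A)$ has the form $$Q(s)=s^{\beta_4}-a s^{\beta_3}-b s^{\beta_2}-c s^{\beta_1}-d$$ with $0<\beta_1<\beta_2<\beta_3<\beta_4$ and $\beta_4<2$, where $\beta_4=\alpha_1+\alpha_2+\alpha_3$, $a,b,c\in\mathbb{R}$ and $d=\det A$. Assume (i) either $a=0$, $b>0$, $c>0$, $1<b\tilde\rho_2+c\tilde\rho_1$ and $$d\le -b\,(b\tilde\rho_2+c\tilde\rho_1)^{\frac{\beta_2}{\beta_4-\beta_2}}\rho_2-c\,(b\tilde\rho_2+c\tilde\rho_1)^{\frac{\beta_1}{\beta_4-\beta_2}}\rho_1;$$ (ii) or $a>0$, $b=0$, $c>0$, $1<a\tilde\rho_3+c\tilde\rho_1$ and $$d\le -a\,(a\tilde\rho_3+c\tilde\rho_1)^{\frac{\beta_3}{\beta_4-\beta_3}}\rho_3-c\,(a\tilde\rho_3+c\tilde\rho_1)^{\frac{\beta_1}{\beta_4-\beta_3}}\rho_1;$$ (iii) or $a>0$, $b>0$, $c=0$, $1<a\tilde\rho_3+b\tilde\rho_2$ and $$d\le -a\,(a\tilde\rho_3+b\tilde\rho_2)^{\frac{\beta_3}{\beta_4-\beta_3}}\rho_3-b\,(a\tilde\rho_3+b\tilde\rho_2)^{\frac{\beta_2}{\beta_4-\beta_3}}\rho_2.$$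 Then all zeros of $Q$ are in the open left half of $\mathbb{C}$.
   Context: Complex powers are taken with the principal branch: $s^\beta=|s|^\beta e^{\mathrm{i}\beta\arg s}$ with $\arg s\in(-\pi,\pi]$ for $s\neq 0$, and $0^\beta=0$ for $\beta>0$. Notation, for $i=1,2,3$: $$\rho_i=\frac{\sin\frac{(\beta_4-\beta_i)\pi}{2}}{\sin\frac{\beta_4\pi}{2}},\qquad \tilde\rho_i=\frac{\sin\frac{\beta_i\pi}{2}}{\sin\frac{\beta_4\pi}{2}}.$$ *)

theory Defs
  imports "HOL-Analysis.Analysis"
begin

definition diag_mat :: "'a::zero ^ 'n \<Rightarrow> 'a ^ 'n ^ 'n" where
  "diag_mat v = (\<chi> i j. if i = j then v $ i else 0)"

(* For complex base, powr is the principal branch: Ln has imaginary part in (-pi, pi],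
   and 0 powr z = 0. *)
definition char_fun :: "real ^ 3 \<Rightarrow> real ^ 3 ^ 3 \<Rightarrow> complex \<Rightarrow> complex" where
  "char_fun \<alpha> A s =
     det (diag_mat (\<chi> i. s powr complex_of_real (\<alpha> $ i)) - map_matrix complex_of_real A)"

definition rho :: "real \<Rightarrow> real \<Rightarrow> real" where
  "rho \<beta>\<^sub>4 \<beta> = sin ((\<beta>\<^sub>4 - \<beta>) * pi / 2) / sin (\<beta>\<^sub>4 * pi / 2)"

definition rho_tilde :: "real \<Rightarrow> real \<Rightarrow> real" where
  "rho_tilde \<beta>\<^sub>4 \<beta> = sin (\<beta> * pi / 2) / sin (\<beta>\<^sub>4 * pi / 2)"

end

theory Submission
  imports Defs
begin

text \<open>
  Write a zero as \<open>s = r e\<^sup>i\<^sup>\<theta>\<close> with \<open>0 \<le> \<theta> \<le> \<pi>/2\<close>. Every case of the hypothesis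
  is a trinomial \<open>s\<^sup>\<gamma> = p s\<^sup>\<mu> + q s\<^sup>\<nu> + d\<close> with \<open>p, q > 0\<close> and \<open>\<nu> < \<mu> < \<gamma> < 2\<close>. For \<open>\<theta> > 0\<close>,
  the imaginary part gives \<open>r\<^sup>\<gamma>\<close> in terms of \<open>r\<^sup>\<mu>\<close> and \<open>r\<^sup>\<nu>\<close>, and eliminating it from the real
  part gives \<open>-d\<close> as a positive combination of \<open>r\<^sup>\<mu>\<close> and \<open>r\<^sup>\<nu>\<close>. All coefficients are quotients
  \<open>sin (x\<theta>) / sin (\<gamma>\<theta>)\<close>, which increase with \<open>\<theta>\<close>, so they are at most the values \<open>rho_tilde\<close> and
  \<open>rho\<close> at \<open>\<theta> = \<pi>/2\<close>. The first relation then forces \<open>r < K powr (1 / (\<gamma> - \<mu>))\<close>, and the second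
  contradicts the bound on \<open>d\<close>. For \<open>\<theta> = 0\<close> the same bound follows from Young's inequality and
  \<open>x / \<gamma> \<le> sin (x \<pi>/2) / sin (\<gamma> \<pi>/2)\<close>.
\<close>

section \<open>Inequalities for sine quotients and powers\<close>

text \<open>The derivative of the quotient has numerator \<open>N u\<close>. It vanishes at 0, and
  its own derivative is a product of \<open>y\<^sup>2 - x\<^sup>2\<close> and two sines, nonnegative
  as long as both angles stay below pi.\<close>

lemma sin_quotient_mono:
  fixes x y s t :: real
  assumes "0 < x" "x \<le> y" "0 < s" "s \<le> t" "y * t < pi"
  shows "sin (x * s) / sin (y * s) \<le> sin (x * t) / sin (y * t)"
proof -
  define N where "N u = x * cos (x * u) * sin (y * u) - y * sin (x * u) * cos (y * u)" for u
  have bound: "x * u < pi" "y * u < pi" if "0 \<le> u" "u \<le> t" for u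
    using that assms mult_right_mono[of x y u] mult_left_mono[of u t y] by linarith+
  have N_nonneg: "0 \<le> N u" if u: "0 \<le> u" "u \<le> t" for u
  proof -
    have "N 0 \<le> N u"
    proof (rule DERIV_nonneg_imp_nondecreasing[OF u(1)])
      fix v assume v: "0 \<le> v" "v \<le> u"
      have "(N has_real_derivative (y\<^sup>2 - x\<^sup>2) * sin (x * v) * sin (y * v)) (at v)"
        unfolding N_def[abs_def]
        by (auto intro!: derivative_eq_intros simp: algebra_simps power2_eq_square)
      moreover have "0 \<le> (y\<^sup>2 - x\<^sup>2) * sin (x * v) * sin (y * v)"
        using assms v u bound[of v] by (intro mult_nonneg_nonneg sin_ge_zero) (auto intro: power_mono)
      ultimately show "\<exists>D. (N has_real_derivative D) (at v) \<and> 0 \<le> D" by blast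
    qed
    then show ?thesis by (simp add: N_def)
  qed
  show ?thesis
  proof (rule DERIV_nonneg_imp_nondecreasing[OF \<open>s \<le> t\<close>])
    fix u assume u: "s \<le> u" "u \<le> t"
    have pos: "0 < sin (y * u)"
      using assms u bound[of u] by (intro sin_gt_zero) auto
    then have "((\<lambda>u. sin (x * u) / sin (y * u)) has_real_derivative N u / (sin (y * u))\<^sup>2) (at u)"
      by (auto intro!: derivative_eq_intros simp: N_def power2_eq_square algebra_simps)
    moreover have "0 \<le> N u / (sin (y * u))\<^sup>2"
      using N_nonneg[of u] assms u by simp
    ultimately show "\<exists>D. ((\<lambda>u. sin (x * u) / sin (y * u)) has_real_derivative D) (at u) \<and> 0 \<le> D"
      by blast
  qed
qed

text \<open>The left side is the limit of the right side as \<open>t\<close> tends to 0, so this is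
  the boundary case of the monotonicity; it serves the positive real axis. Cross-multiplied, it
  follows from cosine decreasing on [0, pi].\<close>

lemma quotient_le_sin_quotient:
  fixes x y t :: real
  assumes "0 < x" "x \<le> y" "0 < t" "y * t < pi"
  shows "x / y \<le> sin (x * t) / sin (y * t)"
proof -
  define N where "N u = y * sin (x * u) - x * sin (y * u)" for u
  have "N 0 \<le> N t"
  proof (rule DERIV_nonneg_imp_nondecreasing[OF less_imp_le[OF \<open>0 < t\<close>]])
    fix u assume u: "0 \<le> u" "u \<le> t"
    have "(N has_real_derivative x * y * (cos (x * u) - cos (y * u))) (at u)"
      unfolding N_def[abs_def] by (auto intro!: derivative_eq_intros simp: algebra_simps)
    moreover have "y * u \<le> y * t" "x * u \<le> y * u"
      using u assms by (auto intro: mult_left_mono mult_right_mono)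
    with assms have "y * u \<le> pi" "x * u \<le> y * u"
      by linarith+
    then have "cos (y * u) \<le> cos (x * u)"
      using u assms by (intro cos_monotone_0_pi_le) auto
    then have "0 \<le> x * y * (cos (x * u) - cos (y * u))"
      using assms by simp
    ultimately show "\<exists>D. (N has_real_derivative D) (at u) \<and> 0 \<le> D" by blast
  qed
  moreover have "0 < sin (y * t)"
    using assms by (intro sin_gt_zero) auto
  ultimately show ?thesis
    using assms by (simp add: N_def field_simps)
qed

text \<open>Convexity of \<open>exp\<close> between 0 and \<open>\<gamma> * ln t\<close>, with
  weight \<open>\<mu> / \<gamma>\<close> on the latter.\<close>

lemma powr_le_Young:
  fixes t \<mu> \<gamma> :: real
  assumes "0 < t" "0 \<le> \<mu>" "\<mu> \<le> \<gamma>" "0 < \<gamma>"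
  shows "t powr \<mu> \<le> \<mu> / \<gamma> * t powr \<gamma> + (1 - \<mu> / \<gamma>)"
proof -
  have "convex_on UNIV (exp :: real \<Rightarrow> real)"
    by (rule exp_convex)
  then have "exp ((1 - \<mu> / \<gamma>) *\<^sub>R 0 + (\<mu> / \<gamma>) *\<^sub>R (\<gamma> * ln t))
      \<le> (1 - \<mu> / \<gamma>) * exp 0 + \<mu> / \<gamma> * exp (\<gamma> * ln t)"
    using assms by (intro convex_onD) auto
  then show ?thesis
    using assms by (simp add: powr_def algebra_simps)
qed

section \<open>Trinomials with two positive coefficients\<close>

context
  fixes \<gamma> \<mu> \<nu> p q K :: real
  assumes exps: "0 < \<nu>" "\<nu> < \<mu>" "\<mu> < \<gamma>" "\<gamma> < 2"
    and coeffs: "0 < p" "0 < q"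
    and K_def: "K = p * rho_tilde \<gamma> \<mu> + q * rho_tilde \<gamma> \<nu>"
    and K_gt_1: "1 < K"
begin

lemma sin_top_pos:
  assumes "0 < \<theta>" "\<theta> \<le> pi / 2"
  shows "0 < sin (\<gamma> * \<theta>)"
proof -
  have "\<gamma> * \<theta> < 2 * \<theta>"
    using exps assms by simp
  then have "\<gamma> * \<theta> < pi"
    using assms by linarith
  then show ?thesis
    using exps assms by (intro sin_gt_zero) auto
qed

lemma rho_tilde_pos: "0 < x \<Longrightarrow> x < 2 \<Longrightarrow> 0 < rho_tilde \<gamma> x"
  using sin_top_pos[of "pi / 2"] exps unfolding rho_tilde_def
  by (intro divide_pos_pos sin_gt_zero) auto

lemma rho_eq_rho_tilde: "rho \<gamma> x = rho_tilde \<gamma> (\<gamma> - x)"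
  by (simp add: rho_def rho_tilde_def)

lemma sin_quotient_le_rho_tilde:
  assumes "0 < x" "x \<le> \<gamma>" "0 < \<theta>" "\<theta> \<le> pi / 2"
  shows "sin (x * \<theta>) / sin (\<gamma> * \<theta>) \<le> rho_tilde \<gamma> x"
  using sin_quotient_mono[of x \<gamma> \<theta> "pi / 2"] assms exps by (simp add: rho_tilde_def)

lemma quotient_le_rho_tilde:
  assumes "0 < x" "x \<le> \<gamma>"
  shows "x / \<gamma> \<le> rho_tilde \<gamma> x"
  using quotient_le_sin_quotient[of x \<gamma> "pi / 2"] assms exps by (simp add: rho_tilde_def)

text \<open>The positive solution \<open>r\<close> of
  \<open>r powr \<gamma> = K * r powr \<mu>\<close>.\<close>

definition "crit_radius = K powr (1 / (\<gamma> - \<mu>))"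

lemma crit_radius_gt_1: "1 < crit_radius"
  using K_gt_1 exps by (simp add: crit_radius_def)

lemma crit_radius_powr: "crit_radius powr x = K powr (x / (\<gamma> - \<mu>))"
  by (simp add: crit_radius_def powr_powr)

text \<open>Above 1 the lower power \<open>r powr \<nu>\<close> is dominated by
  \<open>r powr \<mu>\<close>, so the left side is below \<open>K * r powr \<mu>\<close>; from
  \<open>crit_radius\<close> on, \<open>K\<close> is at most
  \<open>r powr (\<gamma> - \<mu>)\<close>.\<close>

lemma radial_gt:
  assumes "1 < r" "crit_radius \<le> r"
  shows "p * rho_tilde \<gamma> \<mu> * r powr \<mu> + q * rho_tilde \<gamma> \<nu> * r powr \<nu> < r powr \<gamma>"
proof -
  have "q * rho_tilde \<gamma> \<nu> * r powr \<nu> < q * rho_tilde \<gamma> \<nu> * r powr \<mu>"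
    using assms coeffs exps rho_tilde_pos[of \<nu>] by (intro mult_strict_left_mono) auto
  then have "p * rho_tilde \<gamma> \<mu> * r powr \<mu> + q * rho_tilde \<gamma> \<nu> * r powr \<nu> < K * r powr \<mu>"
    by (simp add: K_def algebra_simps)
  also have "K = crit_radius powr (\<gamma> - \<mu>)"
    using K_gt_1 exps by (simp add: crit_radius_powr)
  also have "\<dots> * r powr \<mu> \<le> r powr (\<gamma> - \<mu>) * r powr \<mu>"
    using assms crit_radius_gt_1 exps by (intro mult_right_mono powr_mono2) auto
  also have "\<dots> = r powr \<gamma>"
    by (simp flip: powr_add)
  finally show ?thesis .
qed

text \<open>Young's inequality is applied after scaling by \<open>crit_radius\<close>. The constant
  terms then add up to the claimed bound, and the terms in \<open>t powr \<gamma>\<close> are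
  absorbed by \<open>r powr \<gamma>\<close>.\<close>

lemma trinomial_positive_ray:
  assumes "0 < r"
  shows "- (p * crit_radius powr \<mu> * rho \<gamma> \<mu> + q * crit_radius powr \<nu> * rho \<gamma> \<nu>)
    < r powr \<gamma> - p * r powr \<mu> - q * r powr \<nu>"
proof -
  define R where "R = crit_radius"
  define t where "t = r / R"
  have R: "1 < R" using crit_radius_gt_1 by (simp add: R_def)
  have t: "0 < t" using assms R by (simp add: t_def)
  have r: "r powr x = R powr x * t powr x" for x
    using R t by (simp add: t_def powr_divide)
  have young: "r powr x \<le> R powr x * rho \<gamma> x + t powr \<gamma> * (rho_tilde \<gamma> x * R powr x)"
    if "0 < x" "x < \<gamma>" for x
  proof -
    have "t powr x \<le> x / \<gamma> * t powr \<gamma> + (\<gamma> - x) / \<gamma>"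
      using powr_le_Young[of t x \<gamma>] that t by (simp add: diff_divide_distrib)
    also have "\<dots> \<le> rho_tilde \<gamma> x * t powr \<gamma> + rho \<gamma> x"
      unfolding rho_eq_rho_tilde
      using that by (intro add_mono mult_right_mono quotient_le_rho_tilde) auto
    finally have "R powr x * t powr x \<le> R powr x * (rho_tilde \<gamma> x * t powr \<gamma> + rho \<gamma> x)"
      by (rule mult_left_mono) simp
    then show ?thesis
      by (simp add: r algebra_simps)
  qed
  have "p * r powr \<mu> + q * r powr \<nu>
      \<le> p * (R powr \<mu> * rho \<gamma> \<mu> + t powr \<gamma> * (rho_tilde \<gamma> \<mu> * R powr \<mu>))
        + q * (R powr \<nu> * rho \<gamma> \<nu> + t powr \<gamma> * (rho_tilde \<gamma> \<nu> * R powr \<nu>))"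
    using exps coeffs by (intro add_mono mult_left_mono young) auto
  also have "\<dots> = p * R powr \<mu> * rho \<gamma> \<mu> + q * R powr \<nu> * rho \<gamma> \<nu>
      + t powr \<gamma> * (p * rho_tilde \<gamma> \<mu> * R powr \<mu> + q * rho_tilde \<gamma> \<nu> * R powr \<nu>)"
    by (simp add: algebra_simps)
  \<comment> \<open>\<open>radial_gt\<close> at the critical radius itself bounds the coefficient of
    \<open>t powr \<gamma>\<close>.\<close>
  also have "\<dots> < p * R powr \<mu> * rho \<gamma> \<mu> + q * R powr \<nu> * rho \<gamma> \<nu> + t powr \<gamma> * R powr \<gamma>"
    using radial_gt[of R] R t by (intro add_strict_left_mono mult_strict_left_mono) (auto simp: R_def)
  finally show ?thesis
    by (simp add: r[of \<gamma>] R_def mult.commute)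
qed

lemma trinomial_upper_ray:
  assumes r: "0 < r" and \<theta>: "0 < \<theta>" "\<theta> \<le> pi / 2"
    and Im: "r powr \<gamma> * sin (\<gamma> * \<theta>) = p * r powr \<mu> * sin (\<mu> * \<theta>) + q * r powr \<nu> * sin (\<nu> * \<theta>)"
  shows "- (p * crit_radius powr \<mu> * rho \<gamma> \<mu> + q * crit_radius powr \<nu> * rho \<gamma> \<nu>)
    < r powr \<gamma> * cos (\<gamma> * \<theta>) - p * r powr \<mu> * cos (\<mu> * \<theta>) - q * r powr \<nu> * cos (\<nu> * \<theta>)"
    (is "_ < ?Re")
proof -
  define S where "S = sin (\<gamma> * \<theta>)"
  have S: "0 < S" using sin_top_pos \<theta> by (simp add: S_def)
  have "r powr \<gamma> = p * (sin (\<mu> * \<theta>) / S) * r powr \<mu> + q * (sin (\<nu> * \<theta>) / S) * r powr \<nu>"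
    using Im S by (simp add: S_def field_simps)
  also have "\<dots> \<le> p * rho_tilde \<gamma> \<mu> * r powr \<mu> + q * rho_tilde \<gamma> \<nu> * r powr \<nu>"
    unfolding S_def using exps coeffs \<theta>
    by (intro add_mono mult_right_mono mult_left_mono sin_quotient_le_rho_tilde) auto
  \<comment> \<open>Otherwise \<open>r\<close> would exceed 1 and \<open>radial_gt\<close> would
    contradict the upper bound just found for \<open>r powr \<gamma>\<close>.\<close>
  finally have small: "r < crit_radius"
    using radial_gt[of r] crit_radius_gt_1 by (meson less_le_trans not_le)
  \<comment> \<open>First the angle is raised to pi/2, then the radius to
    \<open>crit_radius\<close>; the second change is strict.\<close>
  have term_less: "r powr x * (sin ((\<gamma> - x) * \<theta>) / S) < crit_radius powr x * rho \<gamma> x"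
    if x: "0 < x" "x < \<gamma>" for x
  proof -
    have "r powr x * (sin ((\<gamma> - x) * \<theta>) / S) \<le> r powr x * rho \<gamma> x"
      unfolding S_def rho_eq_rho_tilde using x \<theta>
      by (intro mult_left_mono sin_quotient_le_rho_tilde) auto
    also have "\<dots> < crit_radius powr x * rho \<gamma> x"
      unfolding rho_eq_rho_tilde using x r small exps
      by (intro mult_strict_right_mono powr_less_mono2 rho_tilde_pos) auto
    finally show ?thesis .
  qed
  \<comment> \<open>Multiplying by \<open>S\<close> lets \<open>Im\<close> replace
    \<open>r powr \<gamma>\<close>; the remaining products combine by the subtraction formula for
    the sine.\<close>
  have "- ?Re * S = p * r powr \<mu> * cos (\<mu> * \<theta>) * S + q * r powr \<nu> * cos (\<nu> * \<theta>) * S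
      - (r powr \<gamma> * sin (\<gamma> * \<theta>)) * cos (\<gamma> * \<theta>)"
    by (simp add: S_def algebra_simps)
  also have "\<dots> = p * r powr \<mu> * sin ((\<gamma> - \<mu>) * \<theta>) + q * r powr \<nu> * sin ((\<gamma> - \<nu>) * \<theta>)"
    unfolding Im by (simp add: S_def left_diff_distrib sin_diff algebra_simps)
  finally have "- ?Re = p * (r powr \<mu> * (sin ((\<gamma> - \<mu>) * \<theta>) / S))
      + q * (r powr \<nu> * (sin ((\<gamma> - \<nu>) * \<theta>) / S))"
    using S by (simp add: field_simps)
  also have "\<dots> < p * (crit_radius powr \<mu> * rho \<gamma> \<mu>) + q * (crit_radius powr \<nu> * rho \<gamma> \<nu>)"
    using exps coeffs by (intro add_strict_mono mult_strict_left_mono term_less) auto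
  finally show ?thesis by (simp add: mult.assoc)
qed

lemma trinomial_zero_Re_neg:
  fixes s :: complex
  assumes d: "d \<le> - p * K powr (\<mu> / (\<gamma> - \<mu>)) * rho \<gamma> \<mu> - q * K powr (\<nu> / (\<gamma> - \<mu>)) * rho \<gamma> \<nu>"
    and zero: "s powr complex_of_real \<gamma> - complex_of_real p * s powr complex_of_real \<mu>
      - complex_of_real q * s powr complex_of_real \<nu> - complex_of_real d = 0"
  shows "Re s < 0"
proof (rule ccontr)
  assume "\<not> Re s < 0"
  have d': "d \<le> - (p * crit_radius powr \<mu> * rho \<gamma> \<mu> + q * crit_radius powr \<nu> * rho \<gamma> \<nu>)"
    using d by (simp add: crit_radius_powr)
  \<comment> \<open>The bound makes \<open>d\<close> negative. This excludes the zero 0, where all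
    powers take the value 0, and so permits polar form.\<close>
  have "0 < rho \<gamma> \<mu>" "0 < rho \<gamma> \<nu>"
    unfolding rho_eq_rho_tilde using exps by (auto intro!: rho_tilde_pos)
  then have "0 < p * crit_radius powr \<mu> * rho \<gamma> \<mu> + q * crit_radius powr \<nu> * rho \<gamma> \<nu>"
    using coeffs crit_radius_gt_1 by (intro add_pos_pos mult_pos_pos) auto
  with d' have "d < 0" by linarith
  with zero have s: "s \<noteq> 0" by auto
  define r where "r = cmod s"
  define \<theta> where "\<theta> = Im (Ln s)"
  have r: "0 < r" using s by (simp add: r_def)
  have \<theta>: "\<bar>\<theta>\<bar> \<le> pi / 2"
    using Re_Ln_pos_le[OF s] \<open>\<not> Re s < 0\<close> by (simp add: \<theta>_def)
  have powr: "Re (s powr complex_of_real x) = r powr x * cos (x * \<theta>)"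
    "Im (s powr complex_of_real x) = r powr x * sin (x * \<theta>)" for x
    using s by (auto simp: powr_def Re_exp Im_exp r_def \<theta>_def)
  have Re: "r powr \<gamma> * cos (\<gamma> * \<theta>) - p * r powr \<mu> * cos (\<mu> * \<theta>) - q * r powr \<nu> * cos (\<nu> * \<theta>) = d"
    using arg_cong[OF zero, of Re] by (simp add: powr)
  have Im: "r powr \<gamma> * sin (\<gamma> * \<theta>) = p * r powr \<mu> * sin (\<mu> * \<theta>) + q * r powr \<nu> * sin (\<nu> * \<theta>)"
    using arg_cong[OF zero, of Im] by (simp add: powr)
  consider "\<theta> = 0" | "0 < \<theta>" | "\<theta> < 0" by linarith
  then show False
  proof cases
    case 1
    then show ?thesis
      using trinomial_positive_ray[OF r] Re d' by simp
  next
    case 2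
    then show ?thesis
      using trinomial_upper_ray[OF r 2 _ Im] \<theta> Re d' by linarith
  next
    \<comment> \<open>The coefficients are real, so passing to the conjugate keeps both relations:
      the real part is even and the imaginary part odd in \<open>\<theta>\<close>.\<close>
    case 3
    then show ?thesis
      using trinomial_upper_ray[OF r, of "- \<theta>"] \<theta> Re Im d' by simp
  qed
qed

end

section \<open>Reduction of the three cases to a trinomial\<close>

theorem lemma13:
  fixes \<alpha> :: "real ^ 3" and A :: "real ^ 3 ^ 3"
    and a b c d \<beta>\<^sub>1 \<beta>\<^sub>2 \<beta>\<^sub>3 \<beta>\<^sub>4 :: real
  assumes alpha: "\<And>i. 0 < \<alpha> $ i \<and> \<alpha> $ i \<le> 1"
    and beta: "0 < \<beta>\<^sub>1" "\<beta>\<^sub>1 < \<beta>\<^sub>2" "\<beta>\<^sub>2 < \<beta>\<^sub>3" "\<beta>\<^sub>3 < \<beta>\<^sub>4" "\<beta>\<^sub>4 < 2"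
    and beta4: "\<beta>\<^sub>4 = \<alpha> $ 1 + \<alpha> $ 2 + \<alpha> $ 3"
    and d: "d = det A"
    and form: "\<And>s. char_fun \<alpha> A s =
        s powr complex_of_real \<beta>\<^sub>4
        - complex_of_real a * s powr complex_of_real \<beta>\<^sub>3
        - complex_of_real b * s powr complex_of_real \<beta>\<^sub>2
        - complex_of_real c * s powr complex_of_real \<beta>\<^sub>1
        - complex_of_real d"
    and cond:
      "(let K = b * rho_tilde \<beta>\<^sub>4 \<beta>\<^sub>2 + c * rho_tilde \<beta>\<^sub>4 \<beta>\<^sub>1 in
          a = 0 \<and> b > 0 \<and> c > 0 \<and> 1 < K \<and>
          d \<le> - b * K powr (\<beta>\<^sub>2 / (\<beta>\<^sub>4 - \<beta>\<^sub>2)) * rho \<beta>\<^sub>4 \<beta>\<^sub>2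
              - c * K powr (\<beta>\<^sub>1 / (\<beta>\<^sub>4 - \<beta>\<^sub>2)) * rho \<beta>\<^sub>4 \<beta>\<^sub>1)
       \<or>
       (let K = a * rho_tilde \<beta>\<^sub>4 \<beta>\<^sub>3 + c * rho_tilde \<beta>\<^sub>4 \<beta>\<^sub>1 in
          a > 0 \<and> b = 0 \<and> c > 0 \<and> 1 < K \<and>
          d \<le> - a * K powr (\<beta>\<^sub>3 / (\<beta>\<^sub>4 - \<beta>\<^sub>3)) * rho \<beta>\<^sub>4 \<beta>\<^sub>3
              - c * K powr (\<beta>\<^sub>1 / (\<beta>\<^sub>4 - \<beta>\<^sub>3)) * rho \<beta>\<^sub>4 \<beta>\<^sub>1)
       \<or>
       (let K = a * rho_tilde \<beta>\<^sub>4 \<beta>\<^sub>3 + b * rho_tilde \<beta>\<^sub>4 \<beta>\<^sub>2 in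
          a > 0 \<and> b > 0 \<and> c = 0 \<and> 1 < K \<and>
          d \<le> - a * K powr (\<beta>\<^sub>3 / (\<beta>\<^sub>4 - \<beta>\<^sub>3)) * rho \<beta>\<^sub>4 \<beta>\<^sub>3
              - b * K powr (\<beta>\<^sub>2 / (\<beta>\<^sub>4 - \<beta>\<^sub>3)) * rho \<beta>\<^sub>4 \<beta>\<^sub>2)"
  shows "\<forall>s. char_fun \<alpha> A s = 0 \<longrightarrow> Re s < 0"
proof (intro allI impI)
  fix s assume "char_fun \<alpha> A s = 0"
  note zero = this[unfolded form]
  \<comment> \<open>The roles of \<open>p\<close>, \<open>\<mu>\<close>, \<open>q\<close>,
    \<open>\<nu>\<close> are played by \<open>b\<close>, \<open>\<beta>\<^sub>2\<close>,
    \<open>c\<close>, \<open>\<beta>\<^sub>1\<close>, then by \<open>a\<close>,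
    \<open>\<beta>\<^sub>3\<close>, \<open>c\<close>, \<open>\<beta>\<^sub>1\<close>, then by
    \<open>a\<close>, \<open>\<beta>\<^sub>3\<close>, \<open>b\<close>,
    \<open>\<beta>\<^sub>2\<close>; the vanishing coefficient removes the fourth power.\<close>
  from cond show "Re s < 0"
    unfolding Let_def
  proof (elim disjE conjE)
    assume "a = 0" "b > 0" "c > 0" and K: "1 < b * rho_tilde \<beta>\<^sub>4 \<beta>\<^sub>2 + c * rho_tilde \<beta>\<^sub>4 \<beta>\<^sub>1"
      and bound: "d \<le> - b * (b * rho_tilde \<beta>\<^sub>4 \<beta>\<^sub>2 + c * rho_tilde \<beta>\<^sub>4 \<beta>\<^sub>1) powr (\<beta>\<^sub>2 / (\<beta>\<^sub>4 - \<beta>\<^sub>2)) * rho \<beta>\<^sub>4 \<beta>\<^sub>2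
        - c * (b * rho_tilde \<beta>\<^sub>4 \<beta>\<^sub>2 + c * rho_tilde \<beta>\<^sub>4 \<beta>\<^sub>1) powr (\<beta>\<^sub>1 / (\<beta>\<^sub>4 - \<beta>\<^sub>2)) * rho \<beta>\<^sub>4 \<beta>\<^sub>1"
    then show ?thesis
      using beta zero by (intro trinomial_zero_Re_neg[OF _ _ _ _ _ _ refl K bound]) auto
  next
    assume "a > 0" "b = 0" "c > 0" and K: "1 < a * rho_tilde \<beta>\<^sub>4 \<beta>\<^sub>3 + c * rho_tilde \<beta>\<^sub>4 \<beta>\<^sub>1"
      and bound: "d \<le> - a * (a * rho_tilde \<beta>\<^sub>4 \<beta>\<^sub>3 + c * rho_tilde \<beta>\<^sub>4 \<beta>\<^sub>1) powr (\<beta>\<^sub>3 / (\<beta>\<^sub>4 - \<beta>\<^sub>3)) * rho \<beta>\<^sub>4 \<beta>\<^sub>3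
        - c * (a * rho_tilde \<beta>\<^sub>4 \<beta>\<^sub>3 + c * rho_tilde \<beta>\<^sub>4 \<beta>\<^sub>1) powr (\<beta>\<^sub>1 / (\<beta>\<^sub>4 - \<beta>\<^sub>3)) * rho \<beta>\<^sub>4 \<beta>\<^sub>1"
    then show ?thesis
      using beta zero by (intro trinomial_zero_Re_neg[OF _ _ _ _ _ _ refl K bound]) auto
  next
    assume "a > 0" "b > 0" "c = 0" and K: "1 < a * rho_tilde \<beta>\<^sub>4 \<beta>\<^sub>3 + b * rho_tilde \<beta>\<^sub>4 \<beta>\<^sub>2"
      and bound: "d \<le> - a * (a * rho_tilde \<beta>\<^sub>4 \<beta>\<^sub>3 + b * rho_tilde \<beta>\<^sub>4 \<beta>\<^sub>2) powr (\<beta>\<^sub>3 / (\<beta>\<^sub>4 - \<beta>\<^sub>3)) * rho \<beta>\<^sub>4 \<beta>\<^sub>3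
        - b * (a * rho_tilde \<beta>\<^sub>4 \<beta>\<^sub>3 + b * rho_tilde \<beta>\<^sub>4 \<beta>\<^sub>2) powr (\<beta>\<^sub>2 / (\<beta>\<^sub>4 - \<beta>\<^sub>3)) * rho \<beta>\<^sub>4 \<beta>\<^sub>2"
    then show ?thesis
      using beta zero by (intro trinomial_zero_Re_neg[OF _ _ _ _ _ _ refl K bound]) auto
  qed
qed

end
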